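(* Group Demand Individual Monotonicity (GDIM) is preserved by GShap, but not by Baseline Shapley (BShap) or Integrated Gradients (IG). That is: (1) For every $m\ge1$, every group structure $B=\{B_1,\dots,B_l\}$ on $\{1,\dots,m\}$, every $i\in B_j$, every $f\in\mathcal F$ that is individually monotonic with respect to $x_i$, all $\overline{\mathbf x}=(\overline x_i,\overline{\mathbf x}_\neg),\mathbf x'\in\mathbb{R}^m$ and all $c>0$, $$\mathrm{GS}_{B_j}\bigl((\overline x_i+c,\overline{\mathbf x}_\neg),\mathbf x',f\bigr)\ \ge\ \mathrm{GS}_{B_j}\bigl((\overline x_i,\overline{\mathbf x}_\neg),\mathbf x',f\bigr).$$ (2) There exist $m$, a group structure $B$, an index $i\in B_j$, a function $f\in\mathcal F$ individually monotonic with respect to $x_i$, points $\overline{\mathbf x},\mathbf x'\in\mathbb{R}^m$ and $c>0$ such that $$\mathrm{BS}_{B_j}\bigl((\overline x_i+c,\overline{\mathbf x}_\neg),\mathbf x',f\bigr)\ <\ \mathrm{BS}_{B_j}\bigl((\overline x_i,\overline{\mathbf x}_\neg),\mathbf x',f\bigr).$$ (3) There exist $m$, a group structure $B$, an index $i\in B_j$, a function $f\in\mathcal F$ individually monotonic with respect to $x_i$ (for which the IG values below are well defined), points $\overline{\mathbf x},\mathbf x'\in\mathbb{R}^m$ and $c>0$ such that $$\mathrm{IG}_{B_j}\bigl((\overline x_i+c,\overline{\mathbf x}_\neg),\mathbf x',f\bigr)\ <\ \mathrm{IG}_{B_j}\bigl((\overline x_i,\overline{\mathbf x}_\neg),\mathbf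 x',f\bigr).$$
   Context: $\mathcal F$ is the class of functions $f:\mathbb{R}^m\to\mathbb{R}$ that are differentiable almost everywhere. A group structure on $M=\{1,\dots,m\}$ is a partition $B=\{B_1,\dots,B_l\}$ of $M$ into pairwise disjoint nonempty sets with union $M$; put $L=\{1,\dots,l\}$. Write $\mathbf x=(x_i,\mathbf x_\neg)$, where $\mathbf x_\neg$ collects the coordinates other than the $i$-th. $f$ is individually monotonic with respect to $x_i$ if $f(x_i,\mathbf x_\neg)\le f(x_i+c,\mathbf x_\neg)$ for all $\mathbf x$ and all $c>0$. For $S\subseteq M$, $v(\overline{\mathbf x},\mathbf x',f;S)=f(\overline{\mathbf x}_S;\mathbf x'_{M\setminus S})$ is the value of $f$ at the point whose $k$-th coordinate is $\overline x_k$ if $k\in S$ and $x'_k$ otherwise. For $T\subseteq L$, $v_B(\overline{\mathbf x},\mathbf x',f;T)=v(\overline{\mathbf x},\mathbf x',f;\bigcup_{k\in T}B_k)$. GShap: $\displaystyle \mathrm{GS}_{B_j}(\overline{\mathbf x},\mathbf x',f)=\sum_{T\subseteq L\setminus\{j\}}\frac{|T|!\,(l-|T|-1)!}{l!}\bigl(v_B(\overline{\mathbf x},\mathbf x',f;T\cup\{j\})-v_B(\overline{\mathbf x},\mathbf x',f;T)\bigr).$ BShap: for $r\in M$, $\displaystyle \mathrm{BS}_r(\overline{\mathbf x},\mathbf x',f)=\sum_{S\subseteq M\setminus\{r\}}\frac{|S|!\,(m-|S|-1)!}{m!}\bigl(v(\overline{\mathbf x},\mathbf x',f;S\cup\{r\})-v(\overline{\mathbf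 x},\mathbf x',f;S)\bigr)$ and $\mathrm{BS}_{B_j}=\sum_{r\in B_j}\mathrm{BS}_r$. IG: for $r\in M$, $\displaystyle \mathrm{IG}_r(\overline{\mathbf x},\mathbf x',f)=(\overline x_r-x'_r)\int_0^1\frac{\partial f}{\partial x_r}\bigl(\mathbf x'+t(\overline{\mathbf x}-\mathbf x')\bigr)dt$ and $\mathrm{IG}_{B_j}=\sum_{r\in B_j}\mathrm{IG}_r$. *)

theory Defs
  imports "HOL-Analysis.Analysis"
begin

text \<open>
  The dimension \<open>m\<close> is quantified over (also existentially), so points of $R^m$ are extensional
  functions on the index set \<open>{1..m}\<close>, and a function on $R^m$ is a function on \<open>nat \<Rightarrow> real\<close> of which
  only the values on \<open>Rn m\<close> are ever used.
\<close>

definition Rn :: "nat \<Rightarrow> (nat \<Rightarrow> real) set" where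
  "Rn m = {1..m} \<rightarrow>\<^sub>E UNIV"

text \<open>Frechet differentiability with respect to the Euclidean norm on \<open>Rn m\<close>; \<open>a\<close> is the gradient.\<close>

definition differentiable_at_Rn :: "nat \<Rightarrow> ((nat \<Rightarrow> real) \<Rightarrow> real) \<Rightarrow> (nat \<Rightarrow> real) \<Rightarrow> bool" where
  "differentiable_at_Rn m f x \<longleftrightarrow>
     (\<exists>a. \<forall>e>0. \<exists>d>0. \<forall>y\<in>Rn m.
        L2_set (\<lambda>k. y k - x k) {1..m} < d \<longrightarrow>
        \<bar>f y - f x - (\<Sum>k\<in>{1..m}. a k * (y k - x k))\<bar> \<le> e * L2_set (\<lambda>k. y k - x k) {1..m})"

text \<open>
  The class $F$ of functions that are differentiable almost everywhere. The product measure lives on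
  \<open>Rn m\<close> and is $m$-dimensional Lebesgue(-Borel) measure; \<open>AE\<close> allows any exceptional set that is
  contained in a Borel null set, so completing the measure would make no difference.
\<close>

definition diff_ae :: "nat \<Rightarrow> ((nat \<Rightarrow> real) \<Rightarrow> real) set" where
  "diff_ae m = {f. AE x in (\<Pi>\<^sub>M k\<in>{1..m}. (lborel :: real measure)). differentiable_at_Rn m f x}"

definition group_structure :: "nat \<Rightarrow> nat \<Rightarrow> (nat \<Rightarrow> nat set) \<Rightarrow> bool" where
  "group_structure m l B \<longleftrightarrow>
     (\<forall>j\<in>{1..l}. B j \<noteq> {}) \<and> disjoint_family_on B {1..l} \<and> (\<Union>j\<in>{1..l}. B j) = {1..m}"

definition indiv_monotonic :: "nat \<Rightarrow> nat \<Rightarrow> ((nat \<Rightarrow> real) \<Rightarrow> real) \<Rightarrow> bool" where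
  "indiv_monotonic m i f \<longleftrightarrow> (\<forall>x\<in>Rn m. \<forall>c>0. f x \<le> f (x(i := x i + c)))"

definition v :: "nat \<Rightarrow> (nat \<Rightarrow> real) \<Rightarrow> (nat \<Rightarrow> real) \<Rightarrow> ((nat \<Rightarrow> real) \<Rightarrow> real) \<Rightarrow> nat set \<Rightarrow> real" where
  "v m xb x' f S = f (\<lambda>k\<in>{1..m}. if k \<in> S then xb k else x' k)"

definition v_group ::
    "nat \<Rightarrow> (nat \<Rightarrow> nat set) \<Rightarrow> (nat \<Rightarrow> real) \<Rightarrow> (nat \<Rightarrow> real) \<Rightarrow> ((nat \<Rightarrow> real) \<Rightarrow> real) \<Rightarrow> nat set \<Rightarrow> real"
  where "v_group m B xb x' f T = v m xb x' f (\<Union>k\<in>T. B k)"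

definition GShap ::
    "nat \<Rightarrow> nat \<Rightarrow> (nat \<Rightarrow> nat set) \<Rightarrow> nat \<Rightarrow> (nat \<Rightarrow> real) \<Rightarrow> (nat \<Rightarrow> real) \<Rightarrow> ((nat \<Rightarrow> real) \<Rightarrow> real) \<Rightarrow> real"
  where
  "GShap m l B j xb x' f =
     (\<Sum>T\<in>Pow ({1..l} - {j}).
        fact (card T) * fact (l - card T - 1) / fact l *
        (v_group m B xb x' f (T \<union> {j}) - v_group m B xb x' f T))"

definition BShap ::
    "nat \<Rightarrow> nat \<Rightarrow> (nat \<Rightarrow> real) \<Rightarrow> (nat \<Rightarrow> real) \<Rightarrow> ((nat \<Rightarrow> real) \<Rightarrow> real) \<Rightarrow> real" where
  "BShap m r xb x' f =
     (\<Sum>S\<in>Pow ({1..m} - {r}).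
        fact (card S) * fact (m - card S - 1) / fact m *
        (v m xb x' f (S \<union> {r}) - v m xb x' f S))"

definition BShap_group ::
    "nat \<Rightarrow> (nat \<Rightarrow> nat set) \<Rightarrow> nat \<Rightarrow> (nat \<Rightarrow> real) \<Rightarrow> (nat \<Rightarrow> real) \<Rightarrow> ((nat \<Rightarrow> real) \<Rightarrow> real) \<Rightarrow> real" where
  "BShap_group m B j xb x' f = (\<Sum>r\<in>B j. BShap m r xb x' f)"

definition has_partial_deriv :: "nat \<Rightarrow> ((nat \<Rightarrow> real) \<Rightarrow> real) \<Rightarrow> (nat \<Rightarrow> real) \<Rightarrow> bool" where
  "has_partial_deriv r f x \<longleftrightarrow> (\<lambda>s. f (x(r := s))) field_differentiable at (x r)"

definition partial_deriv :: "nat \<Rightarrow> ((nat \<Rightarrow> real) \<Rightarrow> real) \<Rightarrow> (nat \<Rightarrow> real) \<Rightarrow> real" where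
  "partial_deriv r f x = deriv (\<lambda>s. f (x(r := s))) (x r)"

definition segment_point :: "nat \<Rightarrow> (nat \<Rightarrow> real) \<Rightarrow> (nat \<Rightarrow> real) \<Rightarrow> real \<Rightarrow> (nat \<Rightarrow> real)" where
  "segment_point m xb x' t = (\<lambda>k\<in>{1..m}. x' k + t * (xb k - x' k))"

definition IG ::
    "nat \<Rightarrow> nat \<Rightarrow> (nat \<Rightarrow> real) \<Rightarrow> (nat \<Rightarrow> real) \<Rightarrow> ((nat \<Rightarrow> real) \<Rightarrow> real) \<Rightarrow> real" where
  "IG m r xb x' f =
     (xb r - x' r) * (LINT t:{0..1}|lborel. partial_deriv r f (segment_point m xb x' t))"

definition IG_group ::
    "nat \<Rightarrow> (nat \<Rightarrow> nat set) \<Rightarrow> nat \<Rightarrow> (nat \<Rightarrow> real) \<Rightarrow> (nat \<Rightarrow> real) \<Rightarrow> ((nat \<Rightarrow> real) \<Rightarrow> real) \<Rightarrow> real" where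
  "IG_group m B j xb x' f = (\<Sum>r\<in>B j. IG m r xb x' f)"

text \<open>
  Since \<open>deriv\<close> and the Lebesgue integral are total, \<open>IG_group\<close> is meaningful only if the partial
  derivatives in question exist along the whole segment and are integrable there.
\<close>

definition IG_well_defined ::
    "nat \<Rightarrow> (nat \<Rightarrow> nat set) \<Rightarrow> nat \<Rightarrow> (nat \<Rightarrow> real) \<Rightarrow> (nat \<Rightarrow> real) \<Rightarrow> ((nat \<Rightarrow> real) \<Rightarrow> real) \<Rightarrow> bool" where
  "IG_well_defined m B j xb x' f \<longleftrightarrow>
     (\<forall>r\<in>B j. (\<forall>t\<in>{0..1}. has_partial_deriv r f (segment_point m xb x' t)) \<and>
               set_integrable lborel {0..1} (\<lambda>t. partial_deriv r f (segment_point m xb x' t)))"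

end

theory Submission
  imports Defs
begin

text \<open>
  Raising \<open>xb i\<close> leaves unchanged the values of all coalitions of groups that avoid \<open>B j\<close> and does
  not lower the others, so every summand of \<open>GShap\<close> can only grow.

  For the other two methods take $f(x) = x_1 (1 - x_2)^2 x_3^2$, the groups $\{1,2\}$ and $\{3\}$,
  baseline $0$ and $\overline{x} = (a, 1, 1)$. As $f(\overline{x}) = f(0) = 0$, efficiency makes the
  attribution to $\{1,2\}$ the negative of the attribution to $3$. The latter is positive for $a > 0$:
  raising $x_3$ pays off as long as $x_2$ has not reached $1$. The values for $\{1,2\}$ are $-a/6$ for
  BShap and $a/30 - a/10 = -a/15$ for IG, which both decrease as $a$ grows from $0$ to $1$.
\<close>

lemma v_upd_notin:
  assumes "i \<notin> S"
  shows "v m (xb(i := a)) x' f S = v m xb x' f S"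
  using assms unfolding v_def by (intro arg_cong[where f = f]) (auto simp: restrict_def)

lemma v_upd_mono:
  assumes "indiv_monotonic m i f" and "i \<in> {1..m}" and "i \<in> S" and "c > 0"
  shows "v m xb x' f S \<le> v m (xb(i := xb i + c)) x' f S"
proof -
  let ?y = "\<lambda>k\<in>{1..m}. if k \<in> S then xb k else x' k"
  have "?y \<in> Rn m"
    by (simp add: Rn_def)
  then have "f ?y \<le> f (?y(i := ?y i + c))"
    using assms unfolding indiv_monotonic_def by blast
  also have "?y(i := ?y i + c) = (\<lambda>k\<in>{1..m}. if k \<in> S then (xb(i := xb i + c)) k else x' k)"
    using assms by (auto simp: restrict_def)
  finally show ?thesis
    unfolding v_def .
qed

lemma GShap_upd_mono:
  assumes B: "group_structure m l B" and j: "j \<in> {1..l}" and i: "i \<in> B j"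
    and f: "indiv_monotonic m i f" and c: "c > 0"
  shows "GShap m l B j xb x' f \<le> GShap m l B j (xb(i := xb i + c)) x' f"
  unfolding GShap_def
proof (intro sum_mono mult_left_mono diff_mono)
  fix T assume T: "T \<in> Pow ({1..l} - {j})"
  have "i \<in> {1..m}"
    using B j i by (auto simp: group_structure_def)
  then show "v_group m B xb x' f (T \<union> {j}) \<le> v_group m B (xb(i := xb i + c)) x' f (T \<union> {j})"
    unfolding v_group_def using i by (intro v_upd_mono f c) auto
  \<comment> \<open>Groups are disjoint and \<open>T\<close> avoids \<open>j\<close>, so no group
    indexed by \<open>T\<close> contains \<open>i\<close>; the subtracted value is
    unchanged.\<close>
  have "i \<notin> B k" if "k \<in> T" for k
    using that T B j i by (fastforce simp: group_structure_def disjoint_family_on_def)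
  then show "v_group m B (xb(i := xb i + c)) x' f T \<le> v_group m B xb x' f T"
    unfolding v_group_def by (subst v_upd_notin) auto
qed simp

lemma atLeastAtMost_1_3: "{1..3::nat} = {1, 2, 3}"
  by auto

text \<open>Bridge to the product type, where derivative rules can be applied. The
  \<open>L2_set\<close> distance on three indices is the norm of
  \<open>real \<times> real \<times> real\<close>, so both epsilon-delta conditions coincide, with
  gradient (a, b, c).\<close>

lemma differentiable_at_Rn_3I:
  fixes F :: "real \<times> real \<times> real \<Rightarrow> real"
  assumes F: "(F has_derivative (\<lambda>(u, v, w). a * u + b * v + c * w)) (at (x 1, x 2, x 3))"
  shows "differentiable_at_Rn 3 (\<lambda>x. F (x 1, x 2, x 3)) x"
proof -
  define D where "D = (\<lambda>k::nat. if k = 1 then a else if k = 2 then b else c)"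
  have L2: "L2_set (\<lambda>k. y k - x k) {1..3} = norm ((y 1, y 2, y 3) - (x 1, x 2, x 3))" for y
    by (simp add: atLeastAtMost_1_3 L2_set_def norm_prod_def add.assoc del: One_nat_def)
  have D: "(\<Sum>k\<in>{1..3}. D k * (y k - x k)) =
      (\<lambda>(u, v, w). a * u + b * v + c * w) ((y 1, y 2, y 3) - (x 1, x 2, x 3))" for y
    by (simp add: atLeastAtMost_1_3 D_def del: One_nat_def)
  show ?thesis
    unfolding differentiable_at_Rn_def
  proof (intro exI[of _ D] allI impI)
    fix e :: real assume "e > 0"
    then obtain d where "d > 0" and d: "\<And>y. norm (y - (x 1, x 2, x 3)) < d \<Longrightarrow>
        norm (F y - F (x 1, x 2, x 3) - (\<lambda>(u, v, w). a * u + b * v + c * w) (y - (x 1, x 2, x 3)))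
          \<le> e * norm (y - (x 1, x 2, x 3))"
      using F unfolding has_derivative_at_alt by meson
    then show "\<exists>d>0. \<forall>y\<in>Rn 3. L2_set (\<lambda>k. y k - x k) {1..3} < d \<longrightarrow>
        \<bar>F (y 1, y 2, y 3) - F (x 1, x 2, x 3) - (\<Sum>k\<in>{1..3}. D k * (y k - x k))\<bar>
          \<le> e * L2_set (\<lambda>k. y k - x k) {1..3}"
      unfolding L2 D real_norm_def[symmetric] by blast
  qed
qed

lemma sum_Pow_doubleton:
  assumes "a \<noteq> b"
  shows "(\<Sum>S\<in>Pow {a, b}. g S) = g {} + g {a} + g {b} + g {a, b}"
proof -
  have "Pow {a, b} = {{}, {a}, {b}, {a, b}}"
    by auto
  then show ?thesis
    using assms by (simp add: add.assoc doubleton_eq_iff)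
qed

definition counterexample :: "(nat \<Rightarrow> real) \<Rightarrow> real" where
  "counterexample x = x 1 * (1 - x 2)\<^sup>2 * (x 3)\<^sup>2"

definition counterexample_point :: "real \<Rightarrow> nat \<Rightarrow> real" where
  "counterexample_point a = (\<lambda>k\<in>{1..3}. if k = 1 then a else 1)"

text \<open>With \<open>l = 2\<close> only the indices 1 and 2 matter; all others get the default
  {3}.\<close>

definition counterexample_groups :: "nat \<Rightarrow> nat set" where
  "counterexample_groups k = (if k = 1 then {1, 2} else {3})"

abbreviation origin3 :: "nat \<Rightarrow> real" where
  "origin3 \<equiv> (\<lambda>k\<in>{1..3}. 0)"

text \<open>The perturbed point stays in the same one-parameter family, so one evaluation for
  general \<open>a\<close> covers both sides of each strict inequality.\<close>

lemma counterexample_point_upd: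
  "(counterexample_point a)(1 := counterexample_point a 1 + c) = counterexample_point (a + c)"
  by (auto simp: counterexample_point_def restrict_def)

lemma counterexample_diff_ae: "counterexample \<in> diff_ae 3"
proof -
  have "differentiable_at_Rn 3 counterexample x" for x
  proof -
    have "((\<lambda>(p, q, r). p * (1 - q)\<^sup>2 * r\<^sup>2 :: real) has_derivative
        (\<lambda>(u, v, w). (1 - x 2)\<^sup>2 * (x 3)\<^sup>2 * u + (- 2 * x 1 * (1 - x 2) * (x 3)\<^sup>2) * v
            + (2 * x 1 * (1 - x 2)\<^sup>2 * x 3) * w)) (at (x 1, x 2, x 3))"
      unfolding case_prod_unfold
      by (auto intro!: derivative_eq_intros ext simp: algebra_simps)
    from differentiable_at_Rn_3I[OF this] show ?thesis
      by (simp add: counterexample_def[abs_def])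
  qed
  then show ?thesis
    by (simp add: diff_ae_def)
qed

text \<open>The coefficient of x_1 is a product of squares, hence nonnegative.\<close>

lemma counterexample_indiv_monotonic: "indiv_monotonic 3 1 counterexample"
  by (simp add: indiv_monotonic_def counterexample_def mult_right_mono)

lemma counterexample_group_structure: "group_structure 3 2 counterexample_groups"
proof -
  have "{1..2::nat} = {1, 2}"
    by auto
  then show ?thesis
    by (simp add: group_structure_def counterexample_groups_def disjoint_family_on_def
        atLeastAtMost_1_3 insert_commute del: One_nat_def)
qed

lemma BShap_group_counterexample:
  "BShap_group 3 counterexample_groups 1 (counterexample_point a) origin3 counterexample = - a / 6"
proof -
  have S: "{1..3} - {1} = {2, 3::nat}" "{1..3} - {2} = {1, 3::nat}"
    by auto
  \<comment> \<open>Only S = {3} contributes: f(a,0,1) - f(0,0,1) = a with weight 1! 1! / 3! = 1/6.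
    If 2 is in S, the factor 1 - x_2 vanishes.\<close>
  have 1: "BShap 3 1 (counterexample_point a) origin3 counterexample = a / 6"
    unfolding BShap_def S
    by (simp add: sum_Pow_doubleton v_def counterexample_def counterexample_point_def
        fact_numeral)
  \<comment> \<open>Only S = {1,3} contributes: f(a,1,1) - f(a,0,1) = -a with weight 2! 0! / 3! =
    1/3.\<close>
  have 2: "BShap 3 2 (counterexample_point a) origin3 counterexample = - a / 3"
    unfolding BShap_def S
    by (simp add: sum_Pow_doubleton v_def counterexample_def counterexample_point_def
        fact_numeral)
  show ?thesis
    by (simp add: BShap_group_def counterexample_groups_def 1 2 del: One_nat_def)
qed

lemma partial_deriv_counterexample:
  shows "((\<lambda>s. counterexample (x(1 := s))) has_field_derivative (1 - x 2)\<^sup>2 * (x 3)\<^sup>2) (at (x 1))"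
    and "((\<lambda>s. counterexample (x(2 := s))) has_field_derivative
           - 2 * x 1 * (1 - x 2) * (x 3)\<^sup>2) (at (x 2))"
  unfolding counterexample_def by (auto intro!: derivative_eq_intros simp: algebra_simps)

text \<open>The segment point at time t is (t a, t, t), which is substituted into the partial
  derivatives.\<close>

lemma partial_deriv_segment_counterexample:
  fixes a t :: real
  defines "p \<equiv> segment_point 3 (counterexample_point a) origin3"
  assumes "t \<in> {0..1}"
  shows "partial_deriv 1 counterexample (p t) = (1 - t)\<^sup>2 * t\<^sup>2"
    and "partial_deriv 2 counterexample (p t) = - 2 * a * (1 - t) * t ^ 3"
  unfolding partial_deriv_def
  unfolding partial_deriv_counterexample[THEN DERIV_imp_deriv]
  by (simp_all add: p_def segment_point_def counterexample_point_def power2_eq_square power3_eq_cube)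

text \<open>The partial derivatives exist everywhere, and on [0,1] the integrands agree with
  polynomials in t, so they are continuous and integrable there.\<close>

lemma IG_well_defined_counterexample:
  "IG_well_defined 3 counterexample_groups 1 (counterexample_point a) origin3 counterexample"
proof -
  have "has_partial_deriv r counterexample x" if "r \<in> {1, 2}" for r x
    using that partial_deriv_counterexample[of x]
    by (auto simp: has_partial_deriv_def field_differentiable_def)
  moreover have "continuous_on {0..1}
      (\<lambda>t. partial_deriv 1 counterexample (segment_point 3 (counterexample_point a) origin3 t))"
    by (rule continuous_on_eq[OF _ partial_deriv_segment_counterexample(1)[symmetric]])
      (intro continuous_intros)
  moreover have "continuous_on {0..1}
      (\<lambda>t. partial_deriv 2 counterexample (segment_point 3 (counterexample_point a) origin3 t))"
    by (rule continuous_on_eq[OF _ partial_deriv_segment_counterexample(2)[symmetric]])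
      (intro continuous_intros)
  ultimately show ?thesis
    by (simp add: IG_well_defined_def counterexample_groups_def borel_integrable_atLeastAtMost'
        del: One_nat_def)
qed

lemma IG_group_counterexample:
  "IG_group 3 counterexample_groups 1 (counterexample_point a) origin3 counterexample = - a / 15"
proof -
  \<comment> \<open>Continuity makes \<open>f\<close> Lebesgue integrable, so its Lebesgue integral
    equals the gauge integral given by the fundamental theorem.\<close>
  have FTC: "(LINT t:{0..1}|lborel. f t) = F 1 - F 0"
    if "\<And>t. (F has_real_derivative f t) (at t)" "continuous_on {0..1} f" for f F :: "real \<Rightarrow> real"
  proof -
    have "(f has_integral (F 1 - F 0)) {0..1}"
      by (intro fundamental_theorem_of_calculus)
        (auto simp: has_real_derivative_iff_has_vector_derivative[symmetric]
          intro: that(1) has_field_derivative_at_within)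
    then show ?thesis
      using borel_integrable_atLeastAtMost'[OF that(2)]
      by (simp add: set_borel_integral_eq_integral integral_unique)
  qed
  \<comment> \<open>The antiderivative comes from expanding to t^2 - 2 t^3 + t^4; its value at 1 is
    1/3 - 1/2 + 1/5.\<close>
  have "(LINT t:{0..1}|lborel. (1 - t)\<^sup>2 * t\<^sup>2) = 1 / (30::real)"
    by (subst FTC[where F = "\<lambda>t. t ^ 3 / 3 - t ^ 4 / 2 + t ^ 5 / 5"])
      (auto intro!: derivative_eq_intros continuous_intros simp: field_simps power_numeral_reduce)
  moreover have "(LINT t:{0..1}|lborel. - 2 * a * (1 - t) * t ^ 3) = - a / 10"
    by (subst FTC[where F = "\<lambda>t. 2 * a * (t ^ 5 / 5 - t ^ 4 / 4)"])
      (auto intro!: derivative_eq_intros continuous_intros simp: field_simps power_numeral_reduce)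
  moreover have "(LINT t:{0..1}|lborel.
        partial_deriv r counterexample (segment_point 3 (counterexample_point a) origin3 t)) =
      (LINT t:{0..1}|lborel. g t)"
    if "\<And>t. t \<in> {0..1} \<Longrightarrow>
        partial_deriv r counterexample (segment_point 3 (counterexample_point a) origin3 t) = g t"
    for r g
    using that by (intro set_lebesgue_integral_cong) auto
  note this[OF partial_deriv_segment_counterexample(1)]
    this[OF partial_deriv_segment_counterexample(2)]
  \<comment> \<open>The prefactors \<open>xb r - x' r\<close> are a for r = 1 and 1 for r =
    2.\<close>
  ultimately have "IG 3 1 (counterexample_point a) origin3 counterexample = a / 30"
    and "IG 3 2 (counterexample_point a) origin3 counterexample = - a / 10"
    by (simp_all add: IG_def counterexample_point_def)
  then show ?thesis
    by (simp add: IG_group_def counterexample_groups_def del: One_nat_def)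
qed

theorem proposition4p15:
  "(\<forall>(m::nat) (l::nat) B i j f xb x' (c::real).
       m \<ge> 1 \<and> group_structure m l B \<and> j \<in> {1..l} \<and> i \<in> B j \<and>
       f \<in> diff_ae m \<and> indiv_monotonic m i f \<and> xb \<in> Rn m \<and> x' \<in> Rn m \<and> c > 0 \<longrightarrow>
       GShap m l B j (xb(i := xb i + c)) x' f \<ge> GShap m l B j xb x' f)
   \<and> (\<exists>(m::nat) (l::nat) B i j f xb x' (c::real).
       m \<ge> 1 \<and> group_structure m l B \<and> j \<in> {1..l} \<and> i \<in> B j \<and>
       f \<in> diff_ae m \<and> indiv_monotonic m i f \<and> xb \<in> Rn m \<and> x' \<in> Rn m \<and> c > 0 \<and>
       BShap_group m B j (xb(i := xb i + c)) x' f < BShap_group m B j xb x' f)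
   \<and> (\<exists>(m::nat) (l::nat) B i j f xb x' (c::real).
       m \<ge> 1 \<and> group_structure m l B \<and> j \<in> {1..l} \<and> i \<in> B j \<and>
       f \<in> diff_ae m \<and> indiv_monotonic m i f \<and> xb \<in> Rn m \<and> x' \<in> Rn m \<and> c > 0 \<and>
       IG_well_defined m B j (xb(i := xb i + c)) x' f \<and> IG_well_defined m B j xb x' f \<and>
       IG_group m B j (xb(i := xb i + c)) x' f < IG_group m B j xb x' f)"
proof (intro conjI)
  show "\<forall>(m::nat) (l::nat) B i j f xb x' (c::real).
       m \<ge> 1 \<and> group_structure m l B \<and> j \<in> {1..l} \<and> i \<in> B j \<and>
       f \<in> diff_ae m \<and> indiv_monotonic m i f \<and> xb \<in> Rn m \<and> x' \<in> Rn m \<and> c > 0 \<longrightarrow>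
       GShap m l B j (xb(i := xb i + c)) x' f \<ge> GShap m l B j xb x' f"
    using GShap_upd_mono by blast
  \<comment> \<open>Unification with these facts supplies the witnesses of both existential claims:
    m = 3, l = 2, i = j = 1, xb = (0,1,1), c = 1. Both points lie in \<open>Rn 3\<close>; the final
    evaluation forces x' to be the origin. The group value falls from 0 to -1/6 for BShap and to
    -1/15 for IG.\<close>
  have common: "(3::nat) \<ge> 1" "(1::nat) \<in> {1..2}" "1 \<in> counterexample_groups 1"
    "counterexample_point 0 \<in> Rn 3" "origin3 \<in> Rn 3" "(1::real) > 0"
    by (auto simp: counterexample_groups_def counterexample_point_def Rn_def)
  note common = common counterexample_group_structure counterexample_diff_ae
    counterexample_indiv_monotonic
  show "\<exists>(m::nat) (l::nat) B i j f xb x' (c::real).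
       m \<ge> 1 \<and> group_structure m l B \<and> j \<in> {1..l} \<and> i \<in> B j \<and>
       f \<in> diff_ae m \<and> indiv_monotonic m i f \<and> xb \<in> Rn m \<and> x' \<in> Rn m \<and> c > 0 \<and>
       BShap_group m B j (xb(i := xb i + c)) x' f < BShap_group m B j xb x' f"
    by (intro exI conjI, (rule common)+)
      (unfold counterexample_point_upd BShap_group_counterexample, simp)
  show "\<exists>(m::nat) (l::nat) B i j f xb x' (c::real).
       m \<ge> 1 \<and> group_structure m l B \<and> j \<in> {1..l} \<and> i \<in> B j \<and>
       f \<in> diff_ae m \<and> indiv_monotonic m i f \<and> xb \<in> Rn m \<and> x' \<in> Rn m \<and> c > 0 \<and>
       IG_well_defined m B j (xb(i := xb i + c)) x' f \<and> IG_well_defined m B j xb x' f \<and>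
       IG_group m B j (xb(i := xb i + c)) x' f < IG_group m B j xb x' f"
    by (intro exI conjI, (rule common)+)
      (unfold counterexample_point_upd IG_group_counterexample,
        simp_all only: IG_well_defined_counterexample, simp)
qed

end
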